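(* Let $V_A,K,T,\lambda,\mu>0$ and $r\in\mathbb{R}$. Let $(X_t)_{t\ge0}$ be, under the risk-neutral measure $\mathbb{Q}$, the NegIG process with shape $\lambda$ and mean $\mu$, i.e. the pure jump Lévy process with Lévy measure $\Pi_I(dx)=\sqrt{\frac{\lambda}{2\pi}}\,\frac{e^{-\frac{\lambda}{2\mu^2}|x|}}{|x|^{3/2}}\mathbf{1}_{\{x<0\}}\,dx$ and $\mathbb{E}^{\mathbb{Q}}[e^{iuX_t}]=e^{t\psi_I(u)}$, where $$\psi_I(u)=\int_{-\infty}^{+\infty}(e^{iux}-1)\,\Pi_I(dx)=\frac{\lambda}{\mu}\left(1-\sqrt{1+2iu\frac{\mu^2}{\lambda}}\right).$$ Let $\omega_I:=\frac{\lambda}{\mu}\left(\sqrt{1+2\frac{\mu^2}{\lambda}}-1\right)$, $V_A(T):=V_A\,e^{(r+\omega_I)T+X_T}$ and $$k_I:=\log\frac{V_A}{K}+\left(r+\frac{\lambda}{\mu}\left(\sqrt{1+2\frac{\mu^2}{\lambda}}-1\right)\right)T .$$ For $x,t,\ell,m>0$ define $$\varphi(x,t,\ell,m):=N\left(\sqrt{\frac{\ell t^2}{x}}\left(\frac{x}{m t}-1\right)\right)+e^{2\frac{\ell t}{m}}\,N\left(-\sqrt{\frac{\ell t^2}{x}}\left(\frac{x}{m t}+1\right)\right),$$ where $N(y)=\frac{1}{\sqrt{2\pi}}\int_{-\infty}^y e^{-z^2/2}\,dz$ is the standard normal cumulative distribution function. Then the equity value $V_E:=e^{-rT}\,\mathbb{E}^{\mathbb{Q}}\left[\max(V_A(T)-K,0)\right]$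 of the firm in the NegIG credit risk model is $$V_E=\begin{cases} V_A\,\varphi\left(k_I\sqrt{1+2\frac{\mu^2}{\lambda}},\,T,\,\lambda\sqrt{1+2\frac{\mu^2}{\lambda}},\,\mu\right)-Ke^{-rT}\,\varphi\left(k_I,T,\lambda,\mu\right) & \text{if } k_I>0,\\[2mm] 0 & \text{if } k_I\le 0.\end{cases}$$
   Context: Structural credit risk setting: a firm has asset value $V_A(t)$, $t\in[0,T]$, with deterministic initial value $V_A:=V_A(0)>0$, and a zero-coupon debt of face value $K$ and maturity $T$; its equity at maturity is $\max(V_A(T)-K,0)$, and its equity value $V_E$ at time $0$ is the discounted $\mathbb{Q}$-expectation of this payoff, $r$ being the continuously compounded risk-free rate. The constant $\omega_I=-\psi_I(-i)$ is the martingale adjustment ensuring $\mathbb{E}^{\mathbb{Q}}[V_A(T)]=e^{rT}V_A$. A Lévy process is a càdlàg process with $X_0=0$ almost surely and independent, stationary increments. For $t>0$ the NegIG process has density $f_I(x,t)=\sqrt{\frac{\lambda t^2}{2\pi}}\,|x|^{-3/2}\exp\left(-\lambda\frac{(|x|-\mu t)^2}{2\mu^2|x|}\right)\mathbf{1}_{\{x<0\}}$. *)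

theory Defs
  imports "HOL-Probability.Probability"
begin

definition cadlag :: "(real \<Rightarrow> real) \<Rightarrow> bool" where
  "cadlag f \<longleftrightarrow>
     (\<forall>t\<ge>0. (f \<longlongrightarrow> f t) (at_right t)) \<and>
     (\<forall>t>0. \<exists>l. (f \<longlongrightarrow> l) (at_left t))"

text \<open>The time parameter ranges over the nonnegative reals; the values \<open>X t\<close> for
  \<open>t < 0\<close> are irrelevant.\<close>

locale levy_process = prob_space M for M :: "'a measure" +
  fixes X :: "real \<Rightarrow> 'a \<Rightarrow> real"
  assumes random_variable_X: "\<And>t. 0 \<le> t \<Longrightarrow> X t \<in> borel_measurable M"
    and cadlag_paths: "AE \<omega> in M. cadlag (\<lambda>t. X t \<omega>)"
    and start_zero: "AE \<omega> in M. X 0 \<omega> = 0"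
    and indep_increments:
      "\<And>(n::nat) \<tau>. 0 \<le> \<tau> 0 \<Longrightarrow> (\<And>i. i < n \<Longrightarrow> \<tau> i < \<tau> (Suc i)) \<Longrightarrow>
         indep_vars (\<lambda>_. borel) (\<lambda>i \<omega>. X (\<tau> (Suc i)) \<omega> - X (\<tau> i) \<omega>) {..<n}"
    and stationary_increments:
      "\<And>s h. 0 \<le> s \<Longrightarrow> 0 \<le> h \<Longrightarrow>
         distr M borel (\<lambda>\<omega>. X (s + h) \<omega> - X s \<omega>) = distr M borel (\<lambda>\<omega>. X h \<omega> - X 0 \<omega>)"

text \<open>Levy measures of finite-variation processes: for these the exponent
  \<open>\<integral> (e\<^sup>i\<^sup>u\<^sup>x - 1) \<nu>(dx)\<close> converges without a compensating term.\<close>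

definition finite_variation_levy_measure :: "real measure \<Rightarrow> bool" where
  "finite_variation_levy_measure \<nu> \<longleftrightarrow>
     sets \<nu> = sets borel \<and> emeasure \<nu> {0} = 0 \<and>
     (\<integral>\<^sup>+ x. ennreal (min 1 \<bar>x\<bar>) \<partial>\<nu>) < \<infinity>"

definition jump_exponent :: "real measure \<Rightarrow> real \<Rightarrow> complex" where
  "jump_exponent \<nu> u = (CLINT x|\<nu>. iexp (u * x) - 1)"

text \<open>The Levy measure is specified through the Levy-Khintchine representation; pure jump
  means that the exponent has neither a Gaussian part nor a drift.\<close>

locale pure_jump_levy_process = levy_process M X
  for M :: "'a measure" and X :: "real \<Rightarrow> 'a \<Rightarrow> real" and \<nu> :: "real measure" +
  assumes levy_measure: "finite_variation_levy_measure \<nu>"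
    and characteristic_function:
      "\<And>t u. 0 \<le> t \<Longrightarrow>
         (CLINT \<omega>|M. iexp (u * X t \<omega>)) = exp (complex_of_real t * jump_exponent \<nu> u)"

definition negIG_levy_measure :: "real \<Rightarrow> real \<Rightarrow> real measure" where
  "negIG_levy_measure lam \<mu> = density lborel (\<lambda>x. ennreal
     (sqrt (lam / (2 * pi)) * (exp (- (lam / (2 * \<mu>\<^sup>2)) * \<bar>x\<bar>) / \<bar>x\<bar> powr (3 / 2))
        * indicator {..<0} x))"

definition negIG_exponent :: "real \<Rightarrow> real \<Rightarrow> real \<Rightarrow> complex" where
  "negIG_exponent lam \<mu> = jump_exponent (negIG_levy_measure lam \<mu>)"

definition negIG_process :: "'a measure \<Rightarrow> (real \<Rightarrow> 'a \<Rightarrow> real) \<Rightarrow> real \<Rightarrow> real \<Rightarrow> bool" where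
  "negIG_process Q X lam \<mu> \<longleftrightarrow> pure_jump_levy_process Q X (negIG_levy_measure lam \<mu>)"

definition negIG_omega :: "real \<Rightarrow> real \<Rightarrow> real" where
  "negIG_omega lam \<mu> = lam / \<mu> * (sqrt (1 + 2 * (\<mu>\<^sup>2 / lam)) - 1)"

definition asset_value ::
    "(real \<Rightarrow> 'a \<Rightarrow> real) \<Rightarrow> real \<Rightarrow> real \<Rightarrow> real \<Rightarrow> real \<Rightarrow> real \<Rightarrow> 'a \<Rightarrow> real" where
  "asset_value X lam \<mu> VA r t \<omega> = VA * exp ((r + negIG_omega lam \<mu>) * t + X t \<omega>)"

definition equity_value :: "'a measure \<Rightarrow> ('a \<Rightarrow> real) \<Rightarrow> real \<Rightarrow> real \<Rightarrow> real \<Rightarrow> real" where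
  "equity_value Q VT K r T = exp (- r * T) * (LINT \<omega>|Q. max (VT \<omega> - K) 0)"

definition negIG_k :: "real \<Rightarrow> real \<Rightarrow> real \<Rightarrow> real \<Rightarrow> real \<Rightarrow> real \<Rightarrow> real" where
  "negIG_k lam \<mu> VA K r T =
     ln (VA / K) + (r + lam / \<mu> * (sqrt (1 + 2 * (\<mu>\<^sup>2 / lam)) - 1)) * T"

definition std_normal_cdf :: "real \<Rightarrow> real" where
  "std_normal_cdf y = 1 / sqrt (2 * pi) * (LBINT z:{..y}. exp (- z\<^sup>2 / 2))"

definition negIG_phi :: "real \<Rightarrow> real \<Rightarrow> real \<Rightarrow> real \<Rightarrow> real" where
  "negIG_phi x t l m =
     std_normal_cdf (sqrt (l * t\<^sup>2 / x) * (x / (m * t) - 1)) +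
     exp (2 * (l * t / m)) * std_normal_cdf (- sqrt (l * t\<^sup>2 / x) * (x / (m * t) + 1))"

end

theory Submission
  imports Defs "HOL-Real_Asymp.Real_Asymp"
begin

text \<open>
  The negative of \<open>X\<^sub>t\<close> is inverse Gaussian with mean \<open>m = \<mu>t\<close> and shape \<open>l = \<lambda>t\<^sup>2\<close>. With \<open>g\<close> the
  density and \<open>H\<^sub>n\<close> the Fourier transform of \<open>y\<^sup>n g y\<close>, integration by parts gives a linear relation
  between \<open>H\<^sub>0\<close>, \<open>H\<^sub>1\<close>, \<open>H\<^sub>2\<close>, i.e. a second order equation for \<open>H\<^sub>0\<close>. It splits into two first order
  equations, and the known mass \<open>1\<close> and mean \<open>m\<close> select the solution
  \<open>H\<^sub>0 u = exp (l / m \<cdot> (1 - R u))\<close> with \<open>R u = (1 - 2\<i>u m\<^sup>2 / l)\<^sup>1\<^sup>/\<^sup>2\<close>. Differentiating at \<open>t = 0\<close>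
  yields the exponent of the Levy measure, so the uniqueness theorem for characteristic functions
  identifies the law of \<open>X\<^sub>T\<close>. The price is then a difference of two inverse Gaussian distribution
  functions, because \<open>e\<^sup>-\<^sup>y g y\<close> is up to a constant the inverse Gaussian density with mean \<open>m / c\<close>,
  \<open>c = (1 + 2 m\<^sup>2 / l)\<^sup>1\<^sup>/\<^sup>2\<close>.
\<close>

subsection \<open>Normal distribution function and calculus\<close>

text \<open>Links the explicit integral to \<open>cdf\<close>, whose limits at both infinities are
  known for probability laws.\<close>

lemma std_normal_cdf_eq_cdf:
  "std_normal_cdf y = cdf (density lborel std_normal_density) y"
proof -
  have "cdf (density lborel std_normal_density) y =
      (LINT z|density lborel std_normal_density. indicator {..y} z)"
    by (simp add: cdf_def)
  also have "\<dots> = (LBINT z. std_normal_density z *\<^sub>R indicator {..y} z)"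
    by (subst integral_density) auto
  also have "\<dots> = (LBINT z. (1 / sqrt (2 * pi)) * (indicator {..y} z *\<^sub>R exp (- z\<^sup>2 / 2)))"
    by (rule Bochner_Integration.integral_cong) (auto simp: std_normal_density_def)
  also have "\<dots> = std_normal_cdf y"
    unfolding std_normal_cdf_def set_lebesgue_integral_def by simp
  finally show ?thesis by simp
qed

lemma real_distribution_std_normal: "real_distribution (density lborel std_normal_density)"
  unfolding real_distribution_def real_distribution_axioms_def
  using prob_space_normal_density[of 1 0] by simp

lemma std_normal_cdf_at_top: "(std_normal_cdf \<longlongrightarrow> 1) at_top"
  using real_distribution.cdf_lim_at_top_prob[OF real_distribution_std_normal]
  by (simp add: std_normal_cdf_eq_cdf[abs_def])

lemma std_normal_cdf_at_bot: "(std_normal_cdf \<longlongrightarrow> 0) at_bot"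
  using finite_borel_measure.cdf_lim_at_bot[OF real_distribution.finite_borel_measure_M
    [OF real_distribution_std_normal]]
  by (simp add: std_normal_cdf_eq_cdf[abs_def])

text \<open>The fundamental theorem is applied on a bounded interval: splitting the half-line at
  \<open>x - 1\<close> keeps \<open>x\<close> interior, and the mass below is a constant.\<close>

lemma DERIV_std_normal_cdf: "DERIV std_normal_cdf x :> std_normal_density x"
proof -
  have int: "set_integrable lborel A std_normal_density" if "A \<in> sets borel" for A
    unfolding set_integrable_def using that integrable_std_normal_moment[of 0]
    by (intro integrable_mult_indicator) auto
  have cdf: "std_normal_cdf y = (LBINT z:{..y}. std_normal_density z)" for y
    unfolding std_normal_cdf_def std_normal_density_def by simp
  have eq: "std_normal_cdf y = (LBINT z=x-1..y. std_normal_density z) + std_normal_cdf (x-1)"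
    if "x - 1 \<le> y" for y
  proof -
    have "{..y} = {..x-1} \<union> {x-1<..y}" using that by auto
    then have "std_normal_cdf y = (LBINT z:{..x-1} \<union> {x-1<..y}. std_normal_density z)"
      by (simp add: cdf)
    also have "\<dots> = (LBINT z:{..x-1}. std_normal_density z) + (LBINT z:{x-1<..y}. std_normal_density z)"
      by (rule set_integral_Un) (auto intro: int)
    finally show ?thesis using that by (simp add: cdf interval_integral_Ioc)
  qed
  have "((\<lambda>u. LBINT y=x-1..u. std_normal_density y) has_vector_derivative std_normal_density x)
      (at x within {x-1..x+1})"
    by (rule interval_integral_FTC2)
       (auto simp: std_normal_density_def intro!: continuous_intros)
  then have "((\<lambda>u. (LBINT y=x-1..u. std_normal_density y) + std_normal_cdf (x-1))
      has_vector_derivative std_normal_density x) (at x within {x-1..x+1})"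
    by (simp only: has_vector_derivative_add_const)
  then have "(std_normal_cdf has_vector_derivative std_normal_density x) (at x within {x-1..x+1})"
    by (rule has_vector_derivative_transform[rotated 2]) (auto intro: eq)
  then show ?thesis
    by (simp add: has_real_derivative_iff_has_vector_derivative at_within_Icc_at)
qed

section \<open>Improper integrals and derivatives of Fourier integrals\<close>

text \<open>Nonnegativity turns integrability into a conclusion: finite limits of the primitive
  suffice. The extended real \<open>b\<close> covers both total integrals and distribution
  functions.\<close>

lemma FTC_nonneg:
  fixes f F :: "real \<Rightarrow> real" and b :: ereal
  assumes "0 < b"
    and F: "\<And>x. 0 < x \<Longrightarrow> DERIV F x :> f x"
    and f: "\<And>x. 0 < x \<Longrightarrow> isCont f x"
    and nonneg: "\<And>x. 0 < x \<Longrightarrow> 0 \<le> f x"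
    and A: "(F \<longlongrightarrow> A) (at_right 0)"
    and B: "((F \<circ> real_of_ereal) \<longlongrightarrow> B) (at_left b)"
  shows "has_bochner_integral lborel (\<lambda>x. indicator (einterval 0 b) x * f x) (B - A)"
proof -
  have A': "((F \<circ> real_of_ereal) \<longlongrightarrow> A) (at_right (0::ereal))"
    using A by (simp add: zero_ereal_def ereal_tendsto_simps)
  note * = interval_integral_FTC_nonneg[OF \<open>0 < b\<close> _ _ _ A' B, of f]
  have "set_integrable lborel (einterval 0 b) f"
    by (rule *) (auto intro: F f nonneg)
  moreover have "(LBINT x=0..b. f x) = B - A"
    by (rule *) (auto intro: F f nonneg)
  ultimately show ?thesis
    using \<open>0 < b\<close> by (simp add: has_bochner_integral_iff set_integrable_def
        interval_lebesgue_integral_def set_lebesgue_integral_def less_imp_le)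
qed

text \<open>Difference quotients can be tested along sequences, which opens the way to dominated
  convergence.\<close>

lemma has_vector_derivative_iff_tendsto:
  "(f has_vector_derivative D) (at x) \<longleftrightarrow> ((\<lambda>y. (f y - f x) /\<^sub>R (y - x)) \<longlongrightarrow> D) (at x)"
proof -
  have eq: "norm ((f y - f x) - (y - x) *\<^sub>R D) / norm (y - x) = norm ((f y - f x) /\<^sub>R (y - x) - D)"
    if "y \<noteq> x" for y
  proof -
    have "(f y - f x) /\<^sub>R (y - x) - D = ((f y - f x) - (y - x) *\<^sub>R D) /\<^sub>R (y - x)"
      using that by (simp add: scaleR_right_diff_distrib)
    then show ?thesis by (simp add: divide_inverse mult.commute)
  qed
  have "(f has_vector_derivative D) (at x) \<longleftrightarrow>
      ((\<lambda>y. norm ((f y - f x) - (y - x) *\<^sub>R D) / norm (y - x)) \<longlongrightarrow> 0) (at x)"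
    unfolding has_vector_derivative_def has_derivative_iff_norm by (simp add: bounded_linear_scaleR_left)
  also have "\<dots> \<longleftrightarrow> ((\<lambda>y. norm ((f y - f x) /\<^sub>R (y - x) - D)) \<longlongrightarrow> 0) (at x)"
    by (rule filterlim_cong[OF refl refl])
       (subst eventually_at_filter, intro always_eventually allI impI, rule eq)
  also have "\<dots> \<longleftrightarrow> ((\<lambda>y. (f y - f x) /\<^sub>R (y - x)) \<longlongrightarrow> D) (at x)"
    by (simp add: tendsto_norm_zero_iff LIM_zero_iff)
  finally show ?thesis .
qed

text \<open>The derivative is obtained by dominated convergence, with the bound \<open>\<bar>y\<bar> \<cdot> \<bar>h y\<bar>\<close>.\<close>
lemma has_vector_derivative_fourier:
  fixes h :: "real \<Rightarrow> real"
  assumes h: "integrable lborel h" and yh: "integrable lborel (\<lambda>y. y * h y)"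
  shows "((\<lambda>u. CLINT y|lborel. iexp (u * y) * of_real (h y)) has_vector_derivative
    \<i> * (CLINT y|lborel. iexp (u * y) * of_real (y * h y))) (at u)"
    (is "(?f has_vector_derivative ?D) _")
proof -
  have [measurable]: "h \<in> borel_measurable lborel" using h by auto
  have int: "integrable lborel (\<lambda>y. iexp (v * y) * of_real (h y))" for v
    by (rule Bochner_Integration.integrable_bound[OF h]) (auto simp: norm_mult)
  have lim: "(\<lambda>n. (?f (S n) - ?f u) /\<^sub>R (S n - u)) \<longlonglongrightarrow> ?D"
    if S: "\<And>n. S n \<noteq> u" "S \<longlonglongrightarrow> u" for S
  proof -
    have eq: "(?f (S n) - ?f u) /\<^sub>R (S n - u) =
       (CLINT y|lborel. (iexp (S n * y) - iexp (u * y)) /\<^sub>R (S n - u) * of_real (h y))" for n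
      by (simp only: Bochner_Integration.integral_diff[OF int int, symmetric] left_diff_distrib
         integral_scaleR_right[symmetric] mult_scaleR_left)
    have "(\<lambda>n. (CLINT y|lborel. (iexp (S n * y) - iexp (u * y)) /\<^sub>R (S n - u) * of_real (h y)))
       \<longlonglongrightarrow> (CLINT y|lborel. \<i> * iexp (u * y) * of_real (y * h y))"
    proof (rule integral_dominated_convergence[where w="\<lambda>y. \<bar>y * h y\<bar>"])
      show "integrable lborel (\<lambda>y. \<bar>y * h y\<bar>)" using yh by simp
      show "AE y in lborel. (\<lambda>n. (iexp (S n * y) - iexp (u * y)) /\<^sub>R (S n - u) * of_real (h y))
          \<longlonglongrightarrow> \<i> * iexp (u * y) * of_real (y * h y)"
      proof (rule AE_I2)
        fix y :: real
        have "((\<lambda>v. iexp (v * y)) has_vector_derivative \<i> * y * iexp (u * y)) (at u)"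
          unfolding of_real_mult
          by (rule has_vector_derivative_real_field[where f="\<lambda>z. exp (\<i> * (z * of_real y))"])
             (auto intro!: derivative_eq_intros)
        then have "((\<lambda>v. (iexp (v * y) - iexp (u * y)) /\<^sub>R (v - u)) \<longlongrightarrow> \<i> * y * iexp (u * y)) (at u)"
          unfolding has_vector_derivative_iff_tendsto .
        then have "(\<lambda>n. (iexp (S n * y) - iexp (u * y)) /\<^sub>R (S n - u)) \<longlonglongrightarrow> \<i> * y * iexp (u * y)"
          using S unfolding tendsto_at_iff_sequentially by (auto simp: o_def)
        from tendsto_mult_right[OF this, of "of_real (h y)"]
        show "(\<lambda>n. (iexp (S n * y) - iexp (u * y)) /\<^sub>R (S n - u) * of_real (h y))
          \<longlonglongrightarrow> \<i> * iexp (u * y) * of_real (y * h y)"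
          by (simp add: mult_ac)
      qed
      show "AE y in lborel. norm ((iexp (S n * y) - iexp (u * y)) /\<^sub>R (S n - u) * of_real (h y))
          \<le> \<bar>y * h y\<bar>" for n
      proof (rule AE_I2)
        fix y
        \<comment> \<open>The common factor \<open>iexp (u * y)\<close> has modulus 1, and the
          distance of \<open>iexp z\<close> from 1 is at most \<open>\<bar>z\<bar>\<close>.\<close>
        have "cmod (iexp (S n * y) - iexp (u * y)) =
            cmod (iexp (u * y) * (iexp ((S n - u) * y) - 1))"
          by (simp add: algebra_simps flip: exp_add)
        also have "\<dots> \<le> \<bar>S n - u\<bar> * \<bar>y\<bar>"
          using iexp_approx1[of "(S n - u) * y" 0] by (simp add: norm_mult abs_mult)
        finally have "cmod (iexp (S n * y) - iexp (u * y)) / \<bar>S n - u\<bar> \<le> \<bar>y\<bar>"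
          using S(1)[of n] by (simp add: divide_le_eq mult.commute)
        from mult_right_mono[OF this, of "\<bar>h y\<bar>"]
        show "norm ((iexp (S n * y) - iexp (u * y)) /\<^sub>R (S n - u) * of_real (h y)) \<le> \<bar>y * h y\<bar>"
          by (simp add: norm_mult abs_mult divide_inverse mult_ac)
      qed
    qed auto
    moreover have "(CLINT y|lborel. \<i> * iexp (u * y) * of_real (y * h y)) = ?D"
      by (simp add: mult.assoc)
    ultimately show ?thesis unfolding eq by simp
  qed
  then have "((\<lambda>v. (?f v - ?f u) /\<^sub>R (v - u)) \<longlongrightarrow> ?D) (at u)"
    unfolding tendsto_at_iff_sequentially by (auto simp: o_def)
  then show ?thesis unfolding has_vector_derivative_iff_tendsto .
qed

lemma constant_if_zero_derivative:
  fixes f :: "real \<Rightarrow> complex"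
  assumes "\<And>u. (f has_vector_derivative 0) (at u)"
  shows "f u = f 0"
  using has_vector_derivative_zero_constant[of UNIV f] assms by (metis UNIV_I convex_UNIV)

subsection \<open>Inverse Gaussian density\<close>

definition ig_density :: "real \<Rightarrow> real \<Rightarrow> real \<Rightarrow> real" where
  "ig_density m l y = (if 0 < y
     then sqrt (l / (2 * pi)) * exp (- (l * (y - m)\<^sup>2 / (2 * m\<^sup>2 * y))) / y powr (3 / 2) else 0)"

text \<open>For \<open>s = 1\<close> this is the distribution function (\<open>negIG_phi\<close>); for \<open>s = -1\<close>, \<open>m\<close> times it is a
  primitive of \<open>y g y\<close>.\<close>
definition ig_primitive :: "real \<Rightarrow> real \<Rightarrow> real \<Rightarrow> real \<Rightarrow> real" where
  "ig_primitive s m l x = std_normal_cdf (sqrt l * (sqrt x / m - 1 / sqrt x)) +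
     s * exp (2 * (l / m)) * std_normal_cdf (- (sqrt l * (sqrt x / m + 1 / sqrt x)))"

lemma powr_three_halves: "0 < x \<Longrightarrow> x powr (3 / 2) = x * sqrt x" for x :: real
  using powr_add[of x 1 "1/2"] by (simp add: powr_half_sqrt)

lemma ig_density_nonneg: "0 \<le> l \<Longrightarrow> 0 \<le> ig_density m l y"
  by (simp add: ig_density_def)

lemma borel_measurable_ig_density [measurable]: "ig_density m l \<in> borel_measurable borel"
  unfolding ig_density_def[abs_def] by measurable

lemma isCont_ig_density: "m \<noteq> 0 \<Longrightarrow> 0 < y \<Longrightarrow> isCont (ig_density m l) y"
proof -
  assume "m \<noteq> 0" "0 < y"
  then have "isCont (\<lambda>y. sqrt (l / (2 * pi)) * exp (- (l * (y - m)\<^sup>2 / (2 * m\<^sup>2 * y))) / y powr (3 / 2)) y"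
    by (auto intro!: continuous_intros)
  moreover have "eventually (\<lambda>y. y \<in> {0<..}) (nhds y)"
    using \<open>0 < y\<close> by (intro eventually_nhds_in_open) auto
  then have "eventually (\<lambda>y. ig_density m l y =
      sqrt (l / (2 * pi)) * exp (- (l * (y - m)\<^sup>2 / (2 * m\<^sup>2 * y))) / y powr (3 / 2)) (nhds y)"
    by eventually_elim (simp add: ig_density_def)
  ultimately show ?thesis by (simp only: isCont_cong)
qed

lemma ig_primitive_eq_negIG_phi:
  assumes "0 < x" "0 < l"
  shows "ig_primitive 1 (m * t) (l * t\<^sup>2) x = negIG_phi x t l m"
proof -
  have 1: "sqrt (l * t\<^sup>2 / x) * (x / (m * t) - 1) = sqrt (l * t\<^sup>2) * (sqrt x / (m * t) - 1 / sqrt x)"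
    and 2: "sqrt (l * t\<^sup>2 / x) * (x / (m * t) + 1) = sqrt (l * t\<^sup>2) * (sqrt x / (m * t) + 1 / sqrt x)"
  proof -
    obtain q where q: "sqrt x = q" "x = q * q" "q > 0" using assms by (metis real_sqrt_gt_0_iff real_sqrt_mult_self abs_of_pos)
    have *: "x / (m * t) / q = q / (m * t)" unfolding q(2) using q(3) by simp
    have "sqrt (l * t\<^sup>2 / x) * (x / (m * t) - 1) = sqrt (l * t\<^sup>2) * (x / (m * t) / q - 1 / q)"
      "sqrt (l * t\<^sup>2 / x) * (x / (m * t) + 1) = sqrt (l * t\<^sup>2) * (x / (m * t) / q + 1 / q)"
      unfolding real_sqrt_divide[of _ x] q(1)
      by (simp_all only: diff_divide_distrib[symmetric] add_divide_distrib[symmetric] times_divide_eq_left times_divide_eq_right)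
    then show "sqrt (l * t\<^sup>2 / x) * (x / (m * t) - 1) = sqrt (l * t\<^sup>2) * (sqrt x / (m * t) - 1 / sqrt x)"
      "sqrt (l * t\<^sup>2 / x) * (x / (m * t) + 1) = sqrt (l * t\<^sup>2) * (sqrt x / (m * t) + 1 / sqrt x)"
      unfolding * q(1) .
  qed
  have 3: "l * t\<^sup>2 / (m * t) = l * t / m" by (simp add: power2_eq_square)
  show ?thesis unfolding ig_primitive_def negIG_phi_def minus_mult_left[symmetric] 1 2 3 by simp
qed

text \<open>The squares of the two normal arguments differ by \<open>4 * (l / m)\<close>, so the
  factor \<open>exp (2 * (l / m))\<close> turns both normal densities into the same
  \<open>E\<close>. The inner derivatives carry \<open>x / m + 1\<close> and
  \<open>1 - x / m\<close>; their combination with weight \<open>s\<close> gives the stated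
  coefficient.\<close>

lemma DERIV_ig_primitive:
  assumes "0 < x" "0 < m" "0 < l"
  shows "DERIV (ig_primitive s m l) x :> ((1 + s) / 2 + (1 - s) / 2 * (x / m)) * ig_density m l x"
proof -
  let ?z1 = "sqrt l * (sqrt x / m - 1 / sqrt x)" and ?z2 = "- (sqrt l * (sqrt x / m + 1 / sqrt x))"
  have sq: "sqrt x * sqrt x = x" "(sqrt x)\<^sup>2 = x" "sqrt x > 0" "(sqrt l)\<^sup>2 = l" using assms by auto
  have e1: "?z1\<^sup>2 = l * (x - m)\<^sup>2 / (m\<^sup>2 * x)"
    unfolding power_mult_distrib sq using assms sq by (simp add: power2_eq_square field_simps)
  have e2: "?z2\<^sup>2 = l * (x - m)\<^sup>2 / (m\<^sup>2 * x) + 4 * (l / m)"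
    unfolding power2_minus power_mult_distrib sq using assms sq by (simp add: power2_eq_square field_simps)
  have d1: "DERIV (\<lambda>x. sqrt l * (sqrt x / m - 1 / sqrt x)) x :> sqrt l / 2 * ((x / m + 1) / (x * sqrt x))"
    using assms sq by (auto intro!: derivative_eq_intros simp: field_simps power2_eq_square)
  have d2: "DERIV (\<lambda>x. - (sqrt l * (sqrt x / m + 1 / sqrt x))) x :> sqrt l / 2 * ((1 - x / m) / (x * sqrt x))"
    using assms sq by (auto intro!: derivative_eq_intros simp: field_simps power2_eq_square)
  define E where "E = exp (- (l * (x - m)\<^sup>2 / (2 * m\<^sup>2 * x))) / sqrt (2 * pi)"
  have n1: "std_normal_density ?z1 = E"
    unfolding std_normal_density_def e1 E_def by (simp add: field_simps)
  have n2: "exp (2 * (l / m)) * std_normal_density ?z2 = E"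
    unfolding std_normal_density_def e2 E_def by (simp add: field_simps flip: exp_add)
  have g: "ig_density m l x = E * (sqrt l / (x * sqrt x))"
    using assms by (simp add: ig_density_def E_def powr_three_halves real_sqrt_divide)
  have "DERIV (ig_primitive s m l) x :>
      std_normal_density ?z1 * (sqrt l / 2 * ((x / m + 1) / (x * sqrt x))) +
      s * exp (2 * (l / m)) * (std_normal_density ?z2 * (sqrt l / 2 * ((1 - x / m) / (x * sqrt x))))"
    unfolding ig_primitive_def[abs_def]
    by (intro DERIV_add DERIV_cmult DERIV_chain2[OF DERIV_std_normal_cdf] d1 d2)
  also have "std_normal_density ?z1 * (sqrt l / 2 * ((x / m + 1) / (x * sqrt x))) +
      s * exp (2 * (l / m)) * (std_normal_density ?z2 * (sqrt l / 2 * ((1 - x / m) / (x * sqrt x)))) =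
      E * (sqrt l / 2 * ((x / m + 1) / (x * sqrt x))) +
      s * E * (sqrt l / 2 * ((1 - x / m) / (x * sqrt x)))"
    unfolding n1 n2[symmetric] by (simp add: mult_ac)
  also have "\<dots> = ((1 + s) / 2 + (1 - s) / 2 * (x / m)) * ig_density m l x"
    unfolding g using assms by (simp add: field_simps)
  finally show ?thesis .
qed

lemma ig_primitive_at_0:
  assumes "0 < m" "0 < l"
  shows "(ig_primitive s m l \<longlongrightarrow> 0) (at_right 0)"
proof -
  have "filterlim (\<lambda>x. sqrt l * (sqrt x / m - 1 / sqrt x)) at_bot (at_right 0)"
    "filterlim (\<lambda>x. - (sqrt l * (sqrt x / m + 1 / sqrt x))) at_bot (at_right 0)"
    using assms by real_asymp+
  from this[THEN filterlim_compose[OF std_normal_cdf_at_bot]]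
  have "(ig_primitive s m l \<longlongrightarrow> 0 + s * exp (2 * (l / m)) * 0) (at_right 0)"
    unfolding ig_primitive_def[abs_def] by (intro tendsto_intros)
  then show ?thesis by simp
qed

text \<open>The second normal argument tends to minus infinity, so the limit does not depend on
  \<open>s\<close>.\<close>

lemma ig_primitive_at_top:
  assumes "0 < m" "0 < l"
  shows "(ig_primitive s m l \<longlongrightarrow> 1) at_top"
proof -
  have "filterlim (\<lambda>x. sqrt l * (sqrt x / m - 1 / sqrt x)) at_top at_top"
    "filterlim (\<lambda>x. - (sqrt l * (sqrt x / m + 1 / sqrt x))) at_bot at_top"
    using assms by real_asymp+
  from filterlim_compose[OF std_normal_cdf_at_top this(1)] filterlim_compose[OF std_normal_cdf_at_bot this(2)]
  have "(ig_primitive s m l \<longlongrightarrow> 1 + s * exp (2 * (l / m)) * 0) at_top"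
    unfolding ig_primitive_def[abs_def] by (intro tendsto_intros)
  then show ?thesis by simp
qed

lemma at_left_infinity: "((F \<circ> real_of_ereal) \<longlongrightarrow> B) (at_left \<infinity>) \<longleftrightarrow> (F \<longlongrightarrow> B) at_top"
  by (simp add: ereal_tendsto_simps)

lemma ig_density_total:
  assumes "0 < m" "0 < l"
  shows "has_bochner_integral lborel (ig_density m l) 1"
proof -
  have "has_bochner_integral lborel (\<lambda>x. indicator (einterval 0 \<infinity>) x * ig_density m l x) (1 - 0)"
  proof (rule FTC_nonneg)
    show "DERIV (ig_primitive 1 m l) x :> ig_density m l x" if "0 < x" for x
      using DERIV_ig_primitive[OF that assms, of 1] by simp
  qed (use assms in \<open>auto simp: isCont_ig_density ig_density_nonneg at_left_infinity
        ig_primitive_at_0 ig_primitive_at_top\<close>)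
  also have "(\<lambda>x. indicator (einterval 0 \<infinity>) x * ig_density m l x) = ig_density m l"
    by (auto simp: ig_density_def indicator_def einterval_def)
  finally show ?thesis by simp
qed

lemma ig_density_cdf:
  assumes "0 < m" "0 < l" "0 < k"
  shows "has_bochner_integral lborel (\<lambda>y. indicator {..<k} y * ig_density m l y) (ig_primitive 1 m l k)"
proof -
  have "has_bochner_integral lborel (\<lambda>x. indicator (einterval 0 k) x * ig_density m l x)
      (ig_primitive 1 m l k - 0)"
  proof (rule FTC_nonneg)
    show D: "DERIV (ig_primitive 1 m l) x :> ig_density m l x" if "0 < x" for x
      using DERIV_ig_primitive[OF that assms(1,2), of 1] by simp
    show "((ig_primitive 1 m l \<circ> real_of_ereal) \<longlongrightarrow> ig_primitive 1 m l k) (at_left (ereal k))"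
      using DERIV_isCont[OF D[OF \<open>0 < k\<close>]]
      by (simp add: ereal_tendsto_simps isCont_def filterlim_at_split)
  qed (use assms in \<open>auto simp: isCont_ig_density ig_density_nonneg ig_primitive_at_0\<close>)
  also have "(\<lambda>x. indicator (einterval 0 k) x * ig_density m l x) = (\<lambda>y. indicator {..<k} y * ig_density m l y)"
    by (auto simp: ig_density_def indicator_def einterval_def)
  finally show ?thesis by simp
qed

lemma ig_density_mean:
  assumes "0 < m" "0 < l"
  shows "has_bochner_integral lborel (\<lambda>y. y * ig_density m l y) m"
proof -
  have "has_bochner_integral lborel (\<lambda>x. indicator (einterval 0 \<infinity>) x * (x * ig_density m l x)) (m * 1 - m * 0)"
  proof (rule FTC_nonneg)
    show "DERIV (\<lambda>x. m * ig_primitive (-1) m l x) x :> x * ig_density m l x" if "0 < x" for x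
      using DERIV_cmult[OF DERIV_ig_primitive[OF that assms, of "-1"], of m] assms by simp
    show "((\<lambda>x. m * ig_primitive (-1) m l x) \<longlongrightarrow> m * 0) (at_right 0)"
      by (intro tendsto_intros ig_primitive_at_0 assms)
    show "(((\<lambda>x. m * ig_primitive (-1) m l x) \<circ> real_of_ereal) \<longlongrightarrow> m * 1) (at_left \<infinity>)"
      unfolding at_left_infinity by (intro tendsto_intros ig_primitive_at_top assms)
  qed (use assms in \<open>auto simp: isCont_ig_density ig_density_nonneg intro!: continuous_intros\<close>)
  also have "(\<lambda>x. indicator (einterval 0 \<infinity>) x * (x * ig_density m l x)) = (\<lambda>x. x * ig_density m l x)"
    by (auto simp: ig_density_def indicator_def einterval_def)
  finally show ?thesis by simp
qed

section \<open>The boundary term \<open>y\<^sup>2 g y\<close> and the second moment\<close>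

lemma ig_density_sq:
  assumes "0 < y"
  shows "y\<^sup>2 * ig_density m l y = sqrt (l / (2 * pi)) * (sqrt y * exp (- (l * (y - m)\<^sup>2 / (2 * m\<^sup>2 * y))))"
proof -
  have *: "y\<^sup>2 / (y * sqrt y) = sqrt y" using assms real_div_sqrt[of y] by (simp add: power2_eq_square)
  have "y\<^sup>2 * ig_density m l y =
      sqrt (l / (2 * pi)) * (y\<^sup>2 / (y * sqrt y) * exp (- (l * (y - m)\<^sup>2 / (2 * m\<^sup>2 * y))))"
    using assms by (simp add: ig_density_def powr_three_halves mult_ac)
  then show ?thesis unfolding * .
qed

text \<open>The logarithmic derivative is
  \<open>1 / (2 * y) - l / (2 * m\<^sup>2) + l / (2 * y\<^sup>2)\<close>. The factor
  \<open>y\<^sup>2\<close> clears its denominators in \<open>y\<close>, leaving a quadratic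
  polynomial times the density, so only three moments enter the Fourier relation.\<close>

lemma DERIV_ig_density_sq:
  assumes "0 < y" "0 < m"
  shows "DERIV (\<lambda>y. y\<^sup>2 * ig_density m l y) y :> (y / 2 - l / (2 * m\<^sup>2) * y\<^sup>2 + l / 2) * ig_density m l y"
proof (rule has_field_derivative_transform_within_open[where S="{0<..}" and
    f="\<lambda>y. sqrt (l / (2 * pi)) * (sqrt y * exp (- (l * (y - m)\<^sup>2 / (2 * m\<^sup>2 * y))))"])
  have sq: "sqrt y * sqrt y = y" "sqrt y > 0" using assms by auto
  let ?E = "exp (- (l * (y - m)\<^sup>2 / (2 * m\<^sup>2 * y)))"
  have d: "DERIV (\<lambda>y. - (l * (y - m)\<^sup>2 / (2 * m\<^sup>2 * y))) y :> - l / (2 * m\<^sup>2) + l / (2 * y\<^sup>2)"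
    using assms by (auto intro!: derivative_eq_intros simp: field_simps power2_eq_square)
  have "DERIV (\<lambda>y. sqrt (l / (2 * pi)) * (sqrt y * exp (- (l * (y - m)\<^sup>2 / (2 * m\<^sup>2 * y))))) y :>
     sqrt (l / (2 * pi)) * (inverse (sqrt y) / 2 * ?E + ?E * (- l / (2 * m\<^sup>2) + l / (2 * y\<^sup>2)) * sqrt y)"
    using assms by (intro DERIV_cmult DERIV_mult DERIV_real_sqrt DERIV_fun_exp d)
  also have "sqrt (l / (2 * pi)) * (inverse (sqrt y) / 2 * ?E + ?E * (- l / (2 * m\<^sup>2) + l / (2 * y\<^sup>2)) * sqrt y) =
     sqrt (l / (2 * pi)) * ?E * (1 / (2 * sqrt y) + (- l / (2 * m\<^sup>2) + l / (2 * y\<^sup>2)) * sqrt y)"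
    by (simp add: field_simps)
  also have "1 / (2 * sqrt y) + (- l / (2 * m\<^sup>2) + l / (2 * y\<^sup>2)) * sqrt y =
     (y / 2 - l / (2 * m\<^sup>2) * y\<^sup>2 + l / 2) / (y * sqrt y)"
  proof -
    have "y = sqrt y * sqrt y" using sq by simp
    then obtain r where r: "r > 0" "sqrt y = r" "y = r * r" using sq by metis
    show ?thesis unfolding r(2) unfolding r(3) using r(1) assms by (simp add: field_simps power2_eq_square)
  qed
  finally show "DERIV (\<lambda>y. sqrt (l / (2 * pi)) * (sqrt y * exp (- (l * (y - m)\<^sup>2 / (2 * m\<^sup>2 * y))))) y :>
     (y / 2 - l / (2 * m\<^sup>2) * y\<^sup>2 + l / 2) * ig_density m l y"
    using assms by (simp add: ig_density_def powr_three_halves mult_ac)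
qed (use assms in \<open>auto simp: ig_density_sq\<close>)

lemma ig_density_sq_at_0:
  assumes "0 < m" "0 < l"
  shows "((\<lambda>y. y\<^sup>2 * ig_density m l y) \<longlongrightarrow> 0) (at_right 0)"
proof (rule Lim_transform_eventually)
  show "((\<lambda>y. sqrt (l / (2 * pi)) * (sqrt y * exp (- (l * (y - m)\<^sup>2 / (2 * m\<^sup>2 * y))))) \<longlongrightarrow> 0) (at_right 0)"
    using assms by real_asymp
qed (auto simp: ig_density_sq eventually_at_right_field intro!: exI[of _ 1])

lemma ig_density_sq_at_top:
  assumes "0 < m" "0 < l"
  shows "((\<lambda>y. y\<^sup>2 * ig_density m l y) \<longlongrightarrow> 0) at_top"
proof (rule Lim_transform_eventually)
  show "((\<lambda>y. sqrt (l / (2 * pi)) * (sqrt y * exp (- (l * (y - m)\<^sup>2 / (2 * m\<^sup>2 * y))))) \<longlongrightarrow> 0) at_top"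
    using assms by real_asymp
  show "\<forall>\<^sub>F y in at_top. sqrt (l / (2 * pi)) * (sqrt y * exp (- (l * (y - m)\<^sup>2 / (2 * m\<^sup>2 * y)))) =
      y\<^sup>2 * ig_density m l y"
    using eventually_gt_at_top[of 0] by eventually_elim (simp only: ig_density_sq)
qed

text \<open>Solving the derivative of \<open>y\<^sup>2 g y\<close> for \<open>y\<^sup>2 g y\<close> yields a primitive of the latter.\<close>
lemma integrable_ig_density_sq:
  assumes "0 < m" "0 < l"
  shows "integrable lborel (\<lambda>y. y\<^sup>2 * ig_density m l y)"
proof -
  let ?g = "ig_density m l"
  \<comment> \<open>Solving gives \<open>y\<^sup>2 g y\<close> as \<open>m\<^sup>2 / l\<close> times
    \<open>y g y\<close>, plus \<open>m\<^sup>2\<close> times \<open>g y\<close>, minus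
    \<open>2 * m\<^sup>2 / l\<close> times the derivative. The third power of \<open>m\<close>
    includes the factor \<open>m\<close> in the primitive of \<open>y g y\<close>.\<close>
  let ?F = "\<lambda>y. m ^ 3 / l * ig_primitive (-1) m l y + m\<^sup>2 * ig_primitive 1 m l y - 2 * m\<^sup>2 / l * (y\<^sup>2 * ?g y)"
  have "has_bochner_integral lborel (\<lambda>x. indicator (einterval 0 \<infinity>) x * (x\<^sup>2 * ig_density m l x))
     ((m ^ 3 / l * 1 + m\<^sup>2 * 1 - 2 * m\<^sup>2 / l * 0) - (m ^ 3 / l * 0 + m\<^sup>2 * 0 - 2 * m\<^sup>2 / l * 0))"
  proof (rule FTC_nonneg)
    show "DERIV ?F x :> x\<^sup>2 * ?g x" if "0 < x" for x
    proof -
      have "DERIV ?F x :> m ^ 3 / l * (((1 + -1) / 2 + (1 - -1) / 2 * (x / m)) * ?g x) +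
         m\<^sup>2 * (((1 + 1) / 2 + (1 - 1) / 2 * (x / m)) * ?g x) -
         2 * m\<^sup>2 / l * ((x / 2 - l / (2 * m\<^sup>2) * x\<^sup>2 + l / 2) * ?g x)"
        using that assms
        by (intro DERIV_add DERIV_diff DERIV_cmult DERIV_ig_primitive DERIV_ig_density_sq)
      then show ?thesis
        by (rule DERIV_cong) (use assms in \<open>simp add: field_simps power2_eq_square power3_eq_cube\<close>)
    qed
    show "(?F \<longlongrightarrow> (m ^ 3 / l * 0 + m\<^sup>2 * 0 - 2 * m\<^sup>2 / l * 0)) (at_right 0)"
      by (intro tendsto_intros ig_primitive_at_0 ig_density_sq_at_0 assms)
    show "((?F \<circ> real_of_ereal) \<longlongrightarrow> (m ^ 3 / l * 1 + m\<^sup>2 * 1 - 2 * m\<^sup>2 / l * 0)) (at_left \<infinity>)"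
      unfolding at_left_infinity
      by (intro tendsto_intros ig_primitive_at_top ig_density_sq_at_top assms)
  qed (use assms in \<open>auto simp: isCont_ig_density ig_density_nonneg intro!: continuous_intros\<close>)
  then have "integrable lborel (\<lambda>x. indicator (einterval 0 \<infinity>) x * (x\<^sup>2 * ig_density m l x))"
    by (simp add: has_bochner_integral_iff)
  also have "(\<lambda>x. indicator (einterval 0 \<infinity>) x * (x\<^sup>2 * ig_density m l x)) = (\<lambda>x. x\<^sup>2 * ig_density m l x)"
    by (auto simp: ig_density_def indicator_def einterval_def)
  finally show ?thesis .
qed

subsection \<open>Inverse Gaussian Fourier transform\<close>

definition ig_fourier :: "nat \<Rightarrow> real \<Rightarrow> real \<Rightarrow> real \<Rightarrow> complex" where
  "ig_fourier n m l u = (CLINT y|lborel. iexp (u * y) * of_real (y ^ n * ig_density m l y))"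

text \<open>The radicand has real part 1, so the principal root never meets its branch cut and never
  vanishes.\<close>

definition ig_root :: "real \<Rightarrow> real \<Rightarrow> real \<Rightarrow> complex" where
  "ig_root m l u = csqrt (1 - 2 * \<i> * of_real u * of_real (m\<^sup>2 / l))"

context
  fixes m l :: real
  assumes pos: "0 < m" "0 < l"
begin

lemma integrable_ig_moment:
  assumes "n \<le> 2"
  shows "integrable lborel (\<lambda>y. y ^ n * ig_density m l y)"
proof -
  have "n = 0 \<or> n = 1 \<or> n = 2" using assms by auto
  then show ?thesis
    using ig_density_total[OF pos] ig_density_mean[OF pos] integrable_ig_density_sq[OF pos]
    by (auto simp: has_bochner_integral_iff)
qed

lemma integrable_ig_fourier:
  assumes "n \<le> 2"
  shows "integrable lborel (\<lambda>y. iexp (u * y) * of_real (y ^ n * ig_density m l y))"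
  by (rule Bochner_Integration.integrable_bound[OF integrable_ig_moment[OF assms]])
     (auto simp: norm_mult norm_power abs_mult power_abs)

lemma has_vector_derivative_ig_fourier:
  assumes "n \<le> 1"
  shows "(ig_fourier n m l has_vector_derivative \<i> * ig_fourier (Suc n) m l u) (at u)"
  unfolding ig_fourier_def[abs_def]
  using has_vector_derivative_fourier[of "\<lambda>y. y ^ n * ig_density m l y" u]
    integrable_ig_moment[of n] integrable_ig_moment[of "Suc n"] assms
  by (simp add: mult.assoc)

text \<open>Integration of the derivative of \<open>y\<^sup>2 g y e\<^sup>i\<^sup>u\<^sup>y\<close> over the half-line.\<close>
lemma ig_fourier_relation:
  "ig_fourier 1 m l u / 2 - (l / (2 * m\<^sup>2) - \<i> * u) * ig_fourier 2 m l u + l / 2 * ig_fourier 0 m l u = 0"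
proof -
  let ?g = "ig_density m l"
  let ?F = "\<lambda>y. iexp (u * y) * of_real (y\<^sup>2 * ?g y)"
  let ?e = "\<lambda>n y. iexp (u * y) * of_real (y ^ n * ?g y)"
  define f where "f y = ?e 1 y / 2 - (l / (2 * m\<^sup>2) - \<i> * u) * ?e 2 y + l / 2 * ?e 0 y" for y
  note int = integrable_ig_fourier[of 0 u] integrable_ig_fourier[of 1 u] integrable_ig_fourier[of 2 u]
  have int_f: "integrable lborel f"
    unfolding f_def using int by auto
  have on_pos: "(\<lambda>x. indicator (einterval 0 \<infinity>) x *\<^sub>R f x) = f"
    by (auto simp: f_def ig_density_def indicator_def einterval_def)
  have "(LBINT y=0..\<infinity>. f y) = 0 - 0"
  proof (rule interval_integral_FTC_integrable)
    show "(?F has_vector_derivative f y) (at y)" if "0 < ereal y" for y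
    proof -
      have "((\<lambda>y. iexp (u * y)) has_vector_derivative \<i> * u * iexp (u * y)) (at y)"
        unfolding of_real_mult
        by (rule has_vector_derivative_real_field[where f="\<lambda>z. exp (\<i> * (of_real u * z))"])
           (auto intro!: derivative_eq_intros)
      moreover have "((\<lambda>y. complex_of_real (y\<^sup>2 * ?g y)) has_vector_derivative
          of_real ((y / 2 - l / (2 * m\<^sup>2) * y\<^sup>2 + l / 2) * ?g y)) (at y)"
        using DERIV_ig_density_sq[of y m l] that pos
        by (intro has_vector_derivative_of_real) auto
      ultimately have "(?F has_vector_derivative
          iexp (u * y) * of_real ((y / 2 - l / (2 * m\<^sup>2) * y\<^sup>2 + l / 2) * ?g y) +
          \<i> * u * iexp (u * y) * of_real (y\<^sup>2 * ?g y)) (at y)"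
        by (rule has_vector_derivative_mult)
      also have "iexp (u * y) * of_real ((y / 2 - l / (2 * m\<^sup>2) * y\<^sup>2 + l / 2) * ?g y) +
          \<i> * u * iexp (u * y) * of_real (y\<^sup>2 * ?g y) = f y"
        unfolding f_def by (simp add: algebra_simps)
      finally show ?thesis .
    qed
    show "isCont f y" if "0 < ereal y" for y
      unfolding f_def using that pos by (auto intro!: continuous_intros isCont_ig_density)
    show "set_integrable lborel (einterval 0 \<infinity>) f"
      unfolding set_integrable_def on_pos by (rule int_f)
    \<comment> \<open>The oscillating factor has modulus 1, so the boundary terms vanish with
      \<open>y\<^sup>2 g y\<close>.\<close>
    have F: "(?F \<longlongrightarrow> 0) G" if "((\<lambda>y. y\<^sup>2 * ?g y) \<longlongrightarrow> 0) G" for G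
      using tendsto_norm_zero[OF that] by (subst tendsto_norm_zero_iff[symmetric]) (simp add: norm_mult norm_power abs_mult)
    show "((?F \<circ> real_of_ereal) \<longlongrightarrow> 0) (at_right 0)"
      using F[OF ig_density_sq_at_0[OF pos]] unfolding zero_ereal_def ereal_tendsto_simps .
    show "((?F \<circ> real_of_ereal) \<longlongrightarrow> 0) (at_left \<infinity>)"
      using F[OF ig_density_sq_at_top[OF pos]] unfolding ereal_tendsto_simps .
  qed auto
  then have "integral\<^sup>L lborel f = 0"
    by (simp add: interval_lebesgue_integral_def set_lebesgue_integral_def on_pos)
  moreover have "integral\<^sup>L lborel f = ig_fourier 1 m l u / 2
      - (l / (2 * m\<^sup>2) - \<i> * u) * ig_fourier 2 m l u + l / 2 * ig_fourier 0 m l u"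
    unfolding f_def ig_fourier_def using int
    by (simp only: Bochner_Integration.integral_add Bochner_Integration.integral_diff
       Bochner_Integration.integrable_add Bochner_Integration.integrable_diff
       integral_mult_right_zero integral_divide_zero integrable_mult_right integrable_divide)
  ultimately show ?thesis by simp
qed

lemma ig_root_sq: "(ig_root m l u)\<^sup>2 = 1 - 2 * \<i> * of_real u * of_real (m\<^sup>2 / l)"
  by (simp add: ig_root_def)

lemma ig_root_nonzero: "ig_root m l u \<noteq> 0"
  using arg_cong[OF ig_root_sq[of u], of Re] by auto

lemma has_vector_derivative_ig_root:
  "(ig_root m l has_vector_derivative - \<i> * of_real (m\<^sup>2 / l) / ig_root m l u) (at u)"
proof -
  have "1 - 2 * \<i> * of_real u * of_real (m\<^sup>2 / l) \<notin> \<real>\<^sub>\<le>\<^sub>0"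
    by (simp add: complex_nonpos_Reals_iff)
  then show ?thesis
    unfolding ig_root_def[abs_def]
    using pos
    by (intro has_vector_derivative_real_field[where f="\<lambda>z. csqrt (1 - 2 * \<i> * z * of_real (m\<^sup>2 / l))"])
       (auto intro!: derivative_eq_intros)
qed

text \<open>Provides the integrating factors of both first order equations, with
  \<open>a = - (l / m)\<close> and \<open>a = l / m\<close>.\<close>

lemma has_vector_derivative_exp_ig_root:
  "((\<lambda>u. exp (of_real a * ig_root m l u)) has_vector_derivative
     - \<i> * of_real (a * m\<^sup>2 / l) / ig_root m l u * exp (of_real a * ig_root m l u)) (at u)"
proof -
  have "((exp \<circ> (\<lambda>u. of_real a * ig_root m l u)) has_vector_derivative
     (of_real a * (- \<i> * of_real (m\<^sup>2 / l) / ig_root m l u)) * exp (of_real a * ig_root m l u)) (at u)"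
    by (intro field_vector_diff_chain_at DERIV_exp has_vector_derivative_mult_right
        has_vector_derivative_ig_root)
  then show ?thesis by (simp add: o_def mult_ac)
qed

text \<open>The relation makes \<open>D = H\<^sub>0 - R H\<^sub>1 / m\<close> a solution of \<open>D' = - \<i> m D / R\<close> with \<open>D(0) = 0\<close>.\<close>
lemma ig_fourier_first: "ig_fourier 0 m l u = ig_root m l u * ig_fourier 1 m l u / m"
proof -
  let ?R = "ig_root m l" and ?H = "\<lambda>n. ig_fourier n m l"
  define D where "D u = ?H 0 u - ?R u * ?H 1 u / m" for u
  have D': "(D has_vector_derivative - (\<i> * m / ?R u) * D u) (at u)" for u
  proof -
    have "(D has_vector_derivative \<i> * ?H 1 u -
        (?R u * (\<i> * ?H 2 u) + - \<i> * of_real (m\<^sup>2 / l) / ?R u * ?H 1 u) / m) (at u)"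
      unfolding D_def
      using has_vector_derivative_ig_fourier[of 0 u] has_vector_derivative_ig_fourier[of 1 u]
      by (intro has_vector_derivative_diff has_vector_derivative_divide has_vector_derivative_mult
          has_vector_derivative_ig_root) (auto simp: numeral_2_eq_2)
    moreover have "\<i> * ?H 1 u - (?R u * (\<i> * ?H 2 u) + - \<i> * of_real (m\<^sup>2 / l) / ?R u * ?H 1 u) / m =
       - (\<i> * m / ?R u) * D u"
    proof -
      \<comment> \<open>The coefficient of \<open>H\<^sub>2\<close> is a multiple of the squared
        root; this is what makes the second order equation factor.\<close>
      have "(l / (2 * m\<^sup>2) - \<i> * u) = l / (2 * m\<^sup>2) * (?R u)\<^sup>2"
        unfolding ig_root_sq using pos by (simp add: field_simps)
      then have "?H 1 u / 2 - l / (2 * m\<^sup>2) * (?R u)\<^sup>2 * ?H 2 u + l / 2 * ?H 0 u = 0"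
        using ig_fourier_relation[of u] by simp
      then have "(?R u)\<^sup>2 * ?H 2 u = m\<^sup>2 / l * ?H 1 u + m\<^sup>2 * ?H 0 u"
        using pos by (simp add: field_simps)
      then have "?R u * ?H 2 u = (m\<^sup>2 / l * ?H 1 u + m\<^sup>2 * ?H 0 u) / ?R u"
        using ig_root_nonzero[of u] by (simp add: field_simps power2_eq_square)
      then have "?R u * (\<i> * ?H 2 u) = \<i> * ((m\<^sup>2 / l * ?H 1 u + m\<^sup>2 * ?H 0 u) / ?R u)"
        by (simp add: mult_ac)
      then show ?thesis unfolding D_def
        using pos ig_root_nonzero[of u] by (simp add: field_simps power2_eq_square)
    qed
    ultimately show ?thesis by simp
  qed
  \<comment> \<open>The exponent is chosen so that the logarithmic derivative of the factor is
    \<open>\<i> * m / ?R u\<close>, opposite to that of \<open>D\<close>.\<close>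
  have "((\<lambda>u. D u * exp (of_real (- (l / m)) * ?R u)) has_vector_derivative 0) (at u)" for u
  proof -
    have "((\<lambda>u. D u * exp (of_real (- (l / m)) * ?R u)) has_vector_derivative
       D u * (- \<i> * of_real (- (l / m) * m\<^sup>2 / l) / ?R u * exp (of_real (- (l / m)) * ?R u)) +
       - (\<i> * m / ?R u) * D u * exp (of_real (- (l / m)) * ?R u)) (at u)"
      by (intro has_vector_derivative_mult D' has_vector_derivative_exp_ig_root)
    moreover have "- (l / m) * m\<^sup>2 / l = - m" using pos by (simp add: power2_eq_square)
    ultimately show ?thesis by (simp add: algebra_simps)
  qed
  then have "D u * exp (of_real (- (l / m)) * ?R u) = D 0 * exp (of_real (- (l / m)) * ?R 0)"
    by (rule constant_if_zero_derivative)
  moreover have "D 0 = 0"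
    using ig_density_total[OF pos] ig_density_mean[OF pos] pos
    by (simp add: D_def ig_fourier_def ig_root_def has_bochner_integral_iff del: of_real_mult)
  ultimately show ?thesis by (simp add: D_def)
qed

text \<open>The first order relation turns \<open>H\<^sub>0' = \<i> H\<^sub>1\<close> into
  \<open>H\<^sub>0' = \<i> m H\<^sub>0 / R\<close>. An integrating factor solves this, and total
  mass 1 fixes the constant.\<close>

lemma ig_fourier_zero: "ig_fourier 0 m l u = exp (of_real (l / m) * (1 - ig_root m l u))"
proof -
  let ?R = "ig_root m l" and ?H = "\<lambda>n. ig_fourier n m l"
  have "((\<lambda>u. ?H 0 u * exp (of_real (l / m) * ?R u)) has_vector_derivative 0) (at u)" for u
  proof -
    have "((\<lambda>u. ?H 0 u * exp (of_real (l / m) * ?R u)) has_vector_derivative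
       ?H 0 u * (- \<i> * of_real (l / m * m\<^sup>2 / l) / ?R u * exp (of_real (l / m) * ?R u)) +
       \<i> * ?H 1 u * exp (of_real (l / m) * ?R u)) (at u)"
      using has_vector_derivative_ig_fourier[of 0 u]
      by (intro has_vector_derivative_mult has_vector_derivative_exp_ig_root) auto
    moreover have "l / m * m\<^sup>2 / l = m" using pos by (simp add: power2_eq_square)
    moreover have "?H 0 u * (- \<i> * of_real m / ?R u * exp (of_real (l / m) * ?R u)) +
       \<i> * ?H 1 u * exp (of_real (l / m) * ?R u) = 0"
      unfolding ig_fourier_first[of u] using ig_root_nonzero[of u] pos by simp
    ultimately show ?thesis by simp
  qed
  then have "?H 0 u * exp (of_real (l / m) * ?R u) = ?H 0 0 * exp (of_real (l / m) * ?R 0)"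
    by (rule constant_if_zero_derivative)
  also have "\<dots> = exp (of_real (l / m))"
    using ig_density_total[OF pos] by (simp add: ig_fourier_def ig_root_def has_bochner_integral_iff)
  finally show ?thesis
    by (simp add: right_diff_distrib exp_diff eq_divide_eq)
qed

end

subsection \<open>NegIG process and call value\<close>

text \<open>Exponential tilting: the extra \<open>y\<close> in the exponent changes its linear
  coefficient from \<open>l / (2 * m\<^sup>2)\<close> to
  \<open>l * c\<^sup>2 / (2 * m\<^sup>2)\<close>, that is, the mean from \<open>m\<close> to
  \<open>m / c\<close>. The \<open>1 / y\<close> term, hence the shape, is unchanged, and the
  constant terms give the prefactor.\<close>

lemma exp_negative_ig_density:
  assumes "0 < m" "0 < l"
  defines "c \<equiv> sqrt (1 + 2 * (m\<^sup>2 / l))"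
  shows "exp (- y) * ig_density m l y = exp (- (l / m * (c - 1))) * ig_density (m / c) l y"
proof (cases "0 < y")
  case True
  have c: "c > 0" "c\<^sup>2 = 1 + 2 * (m\<^sup>2 / l)" using assms by (auto simp: c_def intro!: add_pos_nonneg)
  have "l * (y - m / c)\<^sup>2 / (2 * (m / c)\<^sup>2 * y) = l * (c * y - m)\<^sup>2 / (2 * m\<^sup>2 * y)"
    using c(1) assms(1,2) True by (simp add: field_simps power2_eq_square)
  also have "\<dots> = l * c\<^sup>2 * y / (2 * m\<^sup>2) - l / m * c + l / (2 * y)"
    using assms(1,2) True by (simp add: field_simps power2_eq_square)
  also have "l * c\<^sup>2 * y / (2 * m\<^sup>2) = l * y / (2 * m\<^sup>2) + y"
    unfolding c(2) using assms(1,2) by (simp add: field_simps)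
  finally have "- y + - (l * (y - m)\<^sup>2 / (2 * m\<^sup>2 * y)) =
      - (l / m * (c - 1)) + - (l * (y - m / c)\<^sup>2 / (2 * (m / c)\<^sup>2 * y))"
    using assms(1,2) True by (simp add: field_simps power2_eq_square)
  then have "exp (- y) * exp (- (l * (y - m)\<^sup>2 / (2 * m\<^sup>2 * y))) =
      exp (- (l / m * (c - 1))) * exp (- (l * (y - m / c)\<^sup>2 / (2 * (m / c)\<^sup>2 * y)))"
    unfolding exp_add[symmetric] by (rule arg_cong)
  then show ?thesis using True by (simp add: ig_density_def mult_ac)
qed (simp add: ig_density_def)

text \<open>Multiplying an inverse Gaussian variable by \<open>c\<close> multiplies mean and shape
  by \<open>c\<close>. This converts the tilted mean \<open>m / c\<close> into the scaled arguments
  of \<open>negIG_phi\<close> in the pricing formula.\<close>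

lemma ig_primitive_scale:
  assumes "0 < c" "0 < x"
  shows "ig_primitive s (m * c) (l * c) (x * c) = ig_primitive s m l x"
proof -
  obtain p q where p: "sqrt c = p" "c = p * p" "p > 0" and q: "sqrt x = q" "q > 0"
    using assms by (metis real_sqrt_gt_0_iff real_sqrt_mult_self abs_of_pos)
  have "sqrt (l * c) * (sqrt (x * c) / (m * c) - 1 / sqrt (x * c)) = sqrt l * (sqrt x / m - 1 / sqrt x)"
    "sqrt (l * c) * (sqrt (x * c) / (m * c) + 1 / sqrt (x * c)) = sqrt l * (sqrt x / m + 1 / sqrt x)"
    unfolding real_sqrt_mult p(1) q(1) unfolding p(2) using p(3) q(2) by (simp_all add: field_simps)
  then show ?thesis using assms unfolding ig_primitive_def by simp
qed

text \<open>Bounds the integrand of the exponent by a multiple of the function that a finite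
  variation Levy measure integrates.\<close>

lemma norm_iexp_minus_1_le: "cmod (iexp (u * x) - 1) \<le> max 2 \<bar>u\<bar> * min 1 \<bar>x\<bar>"
proof -
  have 1: "cmod (iexp (u * x) - 1) \<le> \<bar>u\<bar> * \<bar>x\<bar>"
    using iexp_approx1[of "u * x" 0] by (simp add: abs_mult)
  have 2: "cmod (iexp (u * x) - 1) \<le> 2"
    using norm_triangle_ineq4[of "iexp (u * x)" 1] by simp
  show ?thesis
  proof (cases "\<bar>x\<bar> \<le> 1")
    case True
    then show ?thesis using order_trans[OF 1 mult_right_mono[of "\<bar>u\<bar>" "max 2 \<bar>u\<bar>" "\<bar>x\<bar>"]] by simp
  next
    case False
    then show ?thesis using order_trans[OF 2, of "max 2 \<bar>u\<bar>"] by simp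
  qed
qed

section \<open>Levy exponent and marginal law of the NegIG process\<close>

context
  fixes lam \<mu> :: real
  assumes pos: "0 < lam" "0 < \<mu>"
begin

definition negIG_levy_density :: "real \<Rightarrow> real" where
  "negIG_levy_density x = sqrt (lam / (2 * pi)) *
     (exp (- (lam / (2 * \<mu>\<^sup>2)) * \<bar>x\<bar>) / \<bar>x\<bar> powr (3 / 2)) * indicator {..<0} x"

lemma negIG_levy_density_nonneg: "0 \<le> negIG_levy_density x"
  using pos by (simp add: negIG_levy_density_def)

lemma borel_measurable_negIG_levy_density [measurable]: "negIG_levy_density \<in> borel_measurable borel"
  unfolding negIG_levy_density_def[abs_def] by measurable

lemma negIG_levy_measure_eq: "negIG_levy_measure lam \<mu> = density lborel (\<lambda>x. ennreal (negIG_levy_density x))"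
  unfolding negIG_levy_measure_def negIG_levy_density_def by (simp add: mult.assoc)

text \<open>Expanding the square in the exponent isolates the factor \<open>t\<close>; the remaining
  exponentials tend to 1 as \<open>t\<close> tends to 0.\<close>

lemma ig_density_eq_levy_density:
  assumes "0 < t"
  shows "ig_density (\<mu> * t) (lam * t\<^sup>2) (- x) =
    t * (exp (lam * t / \<mu>) * exp (lam * t\<^sup>2 / (2 * x)) * negIG_levy_density x)"
proof (cases "x < 0")
  case True
  have e: "- (lam * t\<^sup>2 * (- x - \<mu> * t)\<^sup>2 / (2 * (\<mu> * t)\<^sup>2 * - x)) =
      lam * t / \<mu> + lam * t\<^sup>2 / (2 * x) + - (lam / (2 * \<mu>\<^sup>2)) * \<bar>x\<bar>"
    using True assms pos by (simp add: field_simps power2_eq_square)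
  have q: "sqrt (lam * t\<^sup>2 / (2 * pi)) = t * sqrt (lam / (2 * pi))"
    using assms by (simp add: real_sqrt_divide real_sqrt_mult)
  have "ig_density (\<mu> * t) (lam * t\<^sup>2) (- x) = t * sqrt (lam / (2 * pi)) *
      exp (lam * t / \<mu> + lam * t\<^sup>2 / (2 * x) + - (lam / (2 * \<mu>\<^sup>2)) * \<bar>x\<bar>) / \<bar>x\<bar> powr (3 / 2)"
    unfolding e[symmetric] q[symmetric] using True by (simp add: ig_density_def)
  then show ?thesis
    unfolding exp_add using True by (simp add: negIG_levy_density_def)
qed (simp add: ig_density_def negIG_levy_density_def)

text \<open>For mean \<open>\<mu> * t\<close> and shape \<open>lam * t\<^sup>2\<close> the root does
  not depend on \<open>t\<close>, while the ratio of shape to mean is linear in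
  \<open>t\<close>.\<close>

lemma ig_fourier_time:
  assumes "0 < t"
  shows "ig_fourier 0 (\<mu> * t) (lam * t\<^sup>2) u =
    exp (of_real t * (of_real (lam / \<mu>) * (1 - ig_root \<mu> lam u)))"
proof -
  have 1: "(\<mu> * t)\<^sup>2 / (lam * t\<^sup>2) = \<mu>\<^sup>2 / lam" and 2: "lam * t\<^sup>2 / (\<mu> * t) = t * (lam / \<mu>)"
    using assms pos by (simp_all add: power_mult_distrib power2_eq_square)
  have "0 < \<mu> * t" "0 < lam * t\<^sup>2" using assms pos by auto
  then show ?thesis
    unfolding ig_root_def by (subst ig_fourier_zero) (simp_all only: ig_root_def 1 2 of_real_mult mult.assoc)
qed

text \<open>The exponent is the derivative at \<open>t = 0\<close> of the Fourier transform of the marginals: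
  \<open>g\<^sub>t / t\<close> converges to the Levy density, dominated by a multiple of it.\<close>
lemma jump_exponent_negIG:
  assumes "finite_variation_levy_measure (negIG_levy_measure lam \<mu>)"
  shows "jump_exponent (negIG_levy_measure lam \<mu>) u = of_real (lam / \<mu>) * (1 - ig_root \<mu> lam (- u))"
    (is "_ = ?\<psi>")
proof -
  let ?k = "negIG_levy_density"
  let ?g = "\<lambda>t. ig_density (\<mu> * t) (lam * t\<^sup>2)"
  have int: "integrable lborel (\<lambda>x. min 1 \<bar>x\<bar> * ?k x)"
  proof (rule integrableI_nonneg)
    have "(\<integral>\<^sup>+ x. ennreal (min 1 \<bar>x\<bar> * ?k x) \<partial>lborel) = (\<integral>\<^sup>+ x. ennreal (min 1 \<bar>x\<bar>) \<partial>negIG_levy_measure lam \<mu>)"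
      unfolding negIG_levy_measure_eq
      by (subst nn_integral_density) (auto simp: ennreal_mult negIG_levy_density_nonneg mult.commute)
    also have "\<dots> < \<infinity>" using assms by (simp add: finite_variation_levy_measure_def)
    finally show "(\<integral>\<^sup>+ x. ennreal (min 1 \<bar>x\<bar> * ?k x) \<partial>lborel) < \<infinity>" .
  qed (auto simp: negIG_levy_density_nonneg)
  have J: "jump_exponent (negIG_levy_measure lam \<mu>) u = (CLINT x|lborel. (iexp (u * x) - 1) * of_real (?k x))"
    unfolding jump_exponent_def negIG_levy_measure_eq
    by (subst integral_density) (auto simp: negIG_levy_density_nonneg scaleR_conv_of_real mult.commute)
  \<comment> \<open>The 1 is written as the total mass of \<open>?g t\<close> to obtain a single
    integral; the reflection of the variable accounts for \<open>- u\<close> in the root.\<close>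
  have H: "(exp (of_real t * ?\<psi>) - 1) / of_real t =
      (CLINT x|lborel. (iexp (u * x) - 1) * of_real (?g t (- x) / t))" if t: "0 < t" for t
  proof -
    have m: "0 < \<mu> * t" "0 < lam * t\<^sup>2" using pos t by auto
    have int1: "integrable lborel (\<lambda>y. complex_of_real (?g t y))"
      using ig_density_total[OF m] by (auto simp: has_bochner_integral_iff)
    have "exp (of_real t * ?\<psi>) - 1 = ig_fourier 0 (\<mu> * t) (lam * t\<^sup>2) (- u) - (CLINT y|lborel. of_real (?g t y))"
      using ig_density_total[OF m] by (simp only: ig_fourier_time[OF t]) (simp add: has_bochner_integral_iff)
    also have "\<dots> = (CLINT y|lborel. (iexp (- u * y) - 1) * of_real (?g t y))"
      unfolding ig_fourier_def
      using integrable_ig_fourier[OF m, of 0 "- u"] int1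
      by (subst Bochner_Integration.integral_diff[symmetric]) (auto simp: left_diff_distrib)
    also have "\<dots> = (CLINT x|lborel. (iexp (u * x) - 1) * of_real (?g t (- x)))"
      by (subst lborel_integral_real_affine[where c="-1" and t=0]) auto
    finally show ?thesis by (simp flip: integral_divide_zero)
  qed
  \<comment> \<open>All \<open>t n\<close> are positive and at most 1, so
    \<open>exp (lam / \<mu>)\<close> serves as a bound for every \<open>n\<close>.\<close>
  define t where "t n = 1 / real (Suc n)" for n
  have t: "0 < t n" "t n \<le> 1" for n by (auto simp: t_def)
  have t0: "t \<longlonglongrightarrow> 0" unfolding t_def by real_asymp
  have "(\<lambda>n. CLINT x|lborel. (iexp (u * x) - 1) * of_real (?g (t n) (- x) / t n))
      \<longlonglongrightarrow> (CLINT x|lborel. (iexp (u * x) - 1) * of_real (?k x))"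
  proof (rule integral_dominated_convergence[where
        w="\<lambda>x. max 2 \<bar>u\<bar> * exp (lam / \<mu>) * (min 1 \<bar>x\<bar> * ?k x)"])
    show "integrable lborel (\<lambda>x. max 2 \<bar>u\<bar> * exp (lam / \<mu>) * (min 1 \<bar>x\<bar> * ?k x))"
      using int by simp
    show "AE x in lborel. (\<lambda>n. (iexp (u * x) - 1) * of_real (?g (t n) (- x) / t n))
        \<longlonglongrightarrow> (iexp (u * x) - 1) * of_real (?k x)"
    proof (rule AE_I2)
      fix x
      have "(\<lambda>n. exp (lam * t n / \<mu>) * exp (lam * (t n)\<^sup>2 / (2 * x)) * ?k x) \<longlonglongrightarrow>
          exp (lam * 0 / \<mu>) * exp (lam * 0\<^sup>2 * inverse (2 * x)) * ?k x"
        unfolding divide_inverse by (intro tendsto_intros t0)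
      also have "(\<lambda>n. exp (lam * t n / \<mu>) * exp (lam * (t n)\<^sup>2 / (2 * x)) * ?k x) =
          (\<lambda>n. ?g (t n) (- x) / t n)"
        using t by (simp add: ig_density_eq_levy_density less_imp_neq[symmetric])
      finally show "(\<lambda>n. (iexp (u * x) - 1) * of_real (?g (t n) (- x) / t n))
        \<longlonglongrightarrow> (iexp (u * x) - 1) * of_real (?k x)"
        by (intro tendsto_intros) simp
    qed
    show "AE x in lborel. norm ((iexp (u * x) - 1) * of_real (?g (t n) (- x) / t n))
        \<le> max 2 \<bar>u\<bar> * exp (lam / \<mu>) * (min 1 \<bar>x\<bar> * ?k x)" for n
    proof (rule AE_I2)
      fix x
      have "?g (t n) (- x) / t n = exp (lam * t n / \<mu>) * exp (lam * (t n)\<^sup>2 / (2 * x)) * ?k x"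
        using t[of n] by (simp add: ig_density_eq_levy_density)
      \<comment> \<open>For negative \<open>x\<close> the second exponent is not positive; for other
        \<open>x\<close> the Levy density vanishes.\<close>
      also have "\<dots> \<le> exp (lam / \<mu>) * 1 * ?k x"
      proof (cases "x < 0")
        case True
        have "exp (lam * t n / \<mu>) \<le> exp (lam / \<mu>)" "exp (lam * (t n)\<^sup>2 / (2 * x)) \<le> 1"
          using t[of n] pos True by (auto simp: divide_right_mono divide_nonneg_neg)
        then show ?thesis by (intro mult_mono) (auto simp: negIG_levy_density_nonneg)
      qed (simp add: negIG_levy_density_def)
      finally have "?g (t n) (- x) / t n \<le> exp (lam / \<mu>) * ?k x" by simp
      moreover have "0 \<le> ?g (t n) (- x) / t n"
        using pos t[of n] by (intro divide_nonneg_pos ig_density_nonneg) auto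
      ultimately have "cmod (iexp (u * x) - 1) * \<bar>?g (t n) (- x) / t n\<bar> \<le>
          (max 2 \<bar>u\<bar> * min 1 \<bar>x\<bar>) * (exp (lam / \<mu>) * ?k x)"
        by (intro mult_mono norm_iexp_minus_1_le) auto
      then show "norm ((iexp (u * x) - 1) * of_real (?g (t n) (- x) / t n))
        \<le> max 2 \<bar>u\<bar> * exp (lam / \<mu>) * (min 1 \<bar>x\<bar> * ?k x)"
        unfolding norm_mult norm_of_real by (simp only: mult_ac)
    qed
  qed auto
  then have lim1: "(\<lambda>n. (exp (of_real (t n) * ?\<psi>) - 1) / of_real (t n))
      \<longlonglongrightarrow> jump_exponent (negIG_levy_measure lam \<mu>) u"
    unfolding J H[OF t(1)] .
  \<comment> \<open>The same quotients are difference quotients of an exponential at 0, which gives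
    their limit a second time.\<close>
  have "((\<lambda>s. exp (of_real s * ?\<psi>)) has_vector_derivative ?\<psi>) (at 0)"
    using pos
    by (intro has_vector_derivative_real_field[where f="\<lambda>z. exp (z * ?\<psi>)"])
       (auto intro!: derivative_eq_intros)
  then have "((\<lambda>s. (exp (of_real s * ?\<psi>) - 1) /\<^sub>R s) \<longlongrightarrow> ?\<psi>) (at 0)"
    unfolding has_vector_derivative_iff_tendsto by simp
  then have "(\<lambda>n. (exp (of_real (t n) * ?\<psi>) - 1) /\<^sub>R t n) \<longlonglongrightarrow> ?\<psi>"
    using t0 less_imp_neq[OF t(1), symmetric]
    unfolding tendsto_at_iff_sequentially by (auto simp: o_def)
  then have "(\<lambda>n. (exp (of_real (t n) * ?\<psi>) - 1) / of_real (t n)) \<longlonglongrightarrow> ?\<psi>"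
    by (simp add: scaleR_conv_of_real divide_inverse mult.commute)
  then show ?thesis using lim1 LIMSEQ_unique by blast
qed

text \<open>The reflection moves the law to the positive half-line. The characteristic function of
  \<open>- X t\<close> at \<open>u\<close> is that of \<open>X t\<close> at \<open>- u\<close>, and
  this second sign change cancels the one in the exponent.\<close>

lemma negIG_law:
  assumes "pure_jump_levy_process Q X (negIG_levy_measure lam \<mu>)" "0 < t"
  shows "distr Q borel (\<lambda>\<omega>. - X t \<omega>) = density lborel (\<lambda>y. ennreal (ig_density (\<mu> * t) (lam * t\<^sup>2) y))"
    (is "?M1 = ?M2")
proof -
  interpret pure_jump_levy_process Q X "negIG_levy_measure lam \<mu>" by fact
  let ?g = "ig_density (\<mu> * t) (lam * t\<^sup>2)"
  have m: "0 < \<mu> * t" "0 < lam * t\<^sup>2" using pos assms(2) by auto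
  have [measurable]: "X t \<in> borel_measurable Q" using random_variable_X assms(2) by simp
  have nn: "0 \<le> ?g y" for y using m by (simp add: ig_density_nonneg)
  show ?thesis
  proof (rule Levy_uniqueness)
    show "real_distribution ?M1" by (rule real_distribution_distr) measurable
    have "emeasure ?M2 (space ?M2) = ennreal (integral\<^sup>L lborel ?g)"
      using ig_density_total[OF m] nn
      by (simp add: emeasure_density has_bochner_integral_iff nn_integral_eq_integral)
    also have "\<dots> = 1" using ig_density_total[OF m] by (simp add: has_bochner_integral_iff)
    finally show "real_distribution ?M2"
      unfolding real_distribution_def real_distribution_axioms_def by (auto intro: prob_spaceI)
    show "char ?M1 = char ?M2"
    proof
      fix u
      have "char ?M1 u = (CLINT \<omega>|Q. iexp (- u * X t \<omega>))"
        unfolding char_def by (subst integral_distr) auto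
      also have "\<dots> = exp (of_real t * (of_real (lam / \<mu>) * (1 - ig_root \<mu> lam u)))"
        using characteristic_function[of t "- u"] assms(2) jump_exponent_negIG[OF levy_measure, of "- u"]
        by simp
      also have "\<dots> = ig_fourier 0 (\<mu> * t) (lam * t\<^sup>2) u"
        by (rule ig_fourier_time[OF assms(2), symmetric])
      also have "\<dots> = char ?M2 u"
        unfolding char_def ig_fourier_def
        by (subst integral_density) (auto simp: nn scaleR_conv_of_real mult.commute)
      finally show "char ?M1 u = char ?M2 u" .
    qed
  qed
qed

end

section \<open>Pricing of the call\<close>

text \<open>The payoff is positive exactly for \<open>y < k\<close>. There the term
  \<open>exp (k - y)\<close> tilts the density and the term 1 leaves it as it is, so each
  contributes a distribution function at \<open>k\<close>. For \<open>k \<le> 0\<close> the payoff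
  vanishes wherever the density does not.\<close>

lemma ig_call_value:
  assumes "0 < m" "0 < l"
  defines "c \<equiv> sqrt (1 + 2 * (m\<^sup>2 / l))"
  shows "(LBINT y. ig_density m l y * max (exp (k - y) - 1) 0) =
    (if 0 < k then exp (k - l / m * (c - 1)) * ig_primitive 1 (m / c) l k - ig_primitive 1 m l k else 0)"
proof (cases "0 < k")
  case True
  have c: "c > 0" using assms by (auto simp: c_def intro!: add_pos_nonneg)
  have eq: "ig_density m l y * max (exp (k - y) - 1) 0 =
     exp (k - l / m * (c - 1)) * (indicator {..<k} y * ig_density (m / c) l y) - indicator {..<k} y * ig_density m l y" for y
  proof (cases "y < k")
    case True
    have "ig_density m l y * max (exp (k - y) - 1) 0 = exp k * (exp (- y) * ig_density m l y) - ig_density m l y"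
      using True by (simp add: max_def exp_diff exp_minus field_simps)
    also have "exp k * (exp (- y) * ig_density m l y) = exp (k - l / m * (c - 1)) * ig_density (m / c) l y"
      unfolding c_def exp_negative_ig_density[OF assms(1,2)] by (simp add: exp_diff exp_minus field_simps)
    finally show ?thesis using True by simp
  qed (simp add: max_def)
  show ?thesis
    unfolding eq using True ig_density_cdf[of m l k] ig_density_cdf[of "m / c" l k] assms(1,2) c
    by (simp add: has_bochner_integral_iff)
next
  case False
  then have "(\<lambda>y. ig_density m l y * max (exp (k - y) - 1) 0) = (\<lambda>y. 0)"
    by (auto simp: ig_density_def max_def)
  then show ?thesis using False by (simp only: if_False integral_zero)
qed

theorem proposition3p2:
  fixes Q :: "'a measure" and X :: "real \<Rightarrow> 'a \<Rightarrow> real"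
    and VA K T lam \<mu> r :: real
  assumes "VA > 0" "K > 0" "T > 0" "lam > 0" "\<mu> > 0"
    and "negIG_process Q X lam \<mu>"
  shows "(\<forall>u::real. negIG_exponent lam \<mu> u =
            complex_of_real (lam / \<mu>) *
              (1 - csqrt (1 + 2 * \<i> * complex_of_real u * complex_of_real (\<mu>\<^sup>2 / lam)))) \<and>
         equity_value Q (asset_value X lam \<mu> VA r T) K r T =
           (let k = negIG_k lam \<mu> VA K r T; c = sqrt (1 + 2 * (\<mu>\<^sup>2 / lam)) in
            if k > 0
            then VA * negIG_phi (k * c) T (lam * c) \<mu> - K * exp (- r * T) * negIG_phi k T lam \<mu>
            else 0)"
proof
  have process: "pure_jump_levy_process Q X (negIG_levy_measure lam \<mu>)"
    using assms(6) by (simp add: negIG_process_def)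
  interpret pure_jump_levy_process Q X "negIG_levy_measure lam \<mu>" by fact
  show "\<forall>u::real. negIG_exponent lam \<mu> u = complex_of_real (lam / \<mu>) *
      (1 - csqrt (1 + 2 * \<i> * complex_of_real u * complex_of_real (\<mu>\<^sup>2 / lam)))"
    unfolding negIG_exponent_def
    by (auto simp: jump_exponent_negIG[OF assms(4,5) levy_measure] ig_root_def)
  define k where "k = negIG_k lam \<mu> VA K r T"
  define c where "c = sqrt (1 + 2 * (\<mu>\<^sup>2 / lam))"
  define m where "m = \<mu> * T"
  define l where "l = lam * T\<^sup>2"
  have ml: "0 < m" "0 < l" using assms by (auto simp: m_def l_def)
  have c: "0 < c" using assms by (auto simp: c_def intro!: add_pos_nonneg)
  \<comment> \<open>The maturity cancels in \<open>m\<^sup>2 / l\<close>.\<close>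
  have c_ml: "sqrt (1 + 2 * (m\<^sup>2 / l)) = c"
    using assms by (simp add: c_def m_def l_def power_mult_distrib)
  have l_m: "l / m = lam / \<mu> * T" using assms by (simp add: l_def m_def power2_eq_square)
  have k: "k = ln (VA / K) + (r + lam / \<mu> * (c - 1)) * T"
    by (simp add: k_def negIG_k_def c_def)
  \<comment> \<open>The face value \<open>K\<close> becomes the unit of account; the double minus
    exhibits the inverse Gaussian variable \<open>- X T\<close>.\<close>
  have asset: "asset_value X lam \<mu> VA r T \<omega> = K * exp (k - - X T \<omega>)" for \<omega>
  proof -
    have "exp (k - - X T \<omega>) = exp (ln (VA / K)) * exp ((r + lam / \<mu> * (c - 1)) * T + X T \<omega>)"
      by (simp add: k flip: exp_add)
    then show ?thesis using assms by (simp add: asset_value_def negIG_omega_def c_def)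
  qed
  have payoff: "max (K * a - K) 0 = K * max (a - 1) 0" for a
    using assms(2) by (simp add: max_mult_distrib_left algebra_simps)
  have [measurable]: "X T \<in> borel_measurable Q" using random_variable_X assms(3) by simp
  have "(LINT \<omega>|Q. max (asset_value X lam \<mu> VA r T \<omega> - K) 0) =
      K * (LINT y|distr Q borel (\<lambda>\<omega>. - X T \<omega>). max (exp (k - y) - 1) 0)"
    unfolding asset payoff by (subst integral_distr) auto
  also have "\<dots> = K * (LBINT y. ig_density m l y * max (exp (k - y) - 1) 0)"
    unfolding negIG_law[OF assms(4,5) process assms(3)] m_def[symmetric] l_def[symmetric]
    using ml by (subst integral_density) (auto simp: ig_density_nonneg)
  finally have price: "equity_value Q (asset_value X lam \<mu> VA r T) K r T = exp (- r * T) *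
      (K * (if 0 < k then exp (k - l / m * (c - 1)) * ig_primitive 1 (m / c) l k - ig_primitive 1 m l k else 0))"
    unfolding equity_value_def ig_call_value[OF ml] c_ml by simp
  have "equity_value Q (asset_value X lam \<mu> VA r T) K r T =
      (if 0 < k then VA * negIG_phi (k * c) T (lam * c) \<mu> - K * exp (- r * T) * negIG_phi k T lam \<mu> else 0)"
  proof (cases "0 < k")
    case True
    \<comment> \<open>The constant from tilting cancels the martingale adjustment contained in
      \<open>k\<close>, so after discounting exactly \<open>VA\<close> remains.\<close>
    have "exp (k - l / m * (c - 1)) = exp (ln (VA / K)) * exp (r * T)"
      by (simp add: k l_m algebra_simps flip: exp_add)
    then have "exp (- r * T) * (K * exp (k - l / m * (c - 1))) = VA"
      using assms(1,2) by (simp add: exp_minus)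
    moreover have "ig_primitive 1 (m / c) l k = negIG_phi (k * c) T (lam * c) \<mu>"
      using ig_primitive_scale[OF c True, of 1 "m / c" l] c True assms(4)
        ig_primitive_eq_negIG_phi[of "k * c" "lam * c" \<mu> T]
      by (simp add: m_def l_def mult_ac)
    moreover have "ig_primitive 1 m l k = negIG_phi k T lam \<mu>"
      unfolding m_def l_def by (rule ig_primitive_eq_negIG_phi[OF True assms(4)])
    ultimately show ?thesis
      unfolding price using True by (simp add: right_diff_distrib)
  qed (simp add: price)
  then show "equity_value Q (asset_value X lam \<mu> VA r T) K r T =
      (let k = negIG_k lam \<mu> VA K r T; c = sqrt (1 + 2 * (\<mu>\<^sup>2 / lam)) in
       if k > 0
       then VA * negIG_phi (k * c) T (lam * c) \<mu> - K * exp (- r * T) * negIG_phi k T lam \<mu>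
       else 0)"
    unfolding Let_def k_def c_def .
qed

end
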